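(* For every tone $k$, user $n$ and approximation point $\tilde{\mathbf s}_k\in\mathcal S_k$, the per-user approximation $f_k^{\mathrm{IASB2}}$, with either of the two choices $L_k^n=y$ or $L_k^n=\min(x,y)$, is tighter than the approximations $f_k^{\mathrm{IASB1}}$ and $f_k^{\mathrm{CADSB}}$ (as functions of $s_k^n\in\mathcal S_k^n$).
   Context: Users $\mathcal N=\{1,\dots,N\}$. On tone $k$, $\mathbf s_k=(s_k^1,\dots,s_k^N)$ are the transmit powers, $\mathcal S_k^n=[0,s_k^{n,\mathrm{mask}}]$ with $s_k^{n,\mathrm{mask}}>0$, $\mathcal S_k=\prod_n\mathcal S_k^n$. Constants: weights $w_n\ge0$, gains $a_k^{n,m}\ge0$, noise powers $z_k^n>0$. Put $\mathrm{int}_k^n=\sum_{m\ne n}a_k^{n,m}s_k^m+z_k^n$, $\mathrm{rec}_k^n=s_k^n+\mathrm{int}_k^n$, and $f_k(\mathbf s_k)=-\sum_{m\in\mathcal N}w_m\log(1+s_k^m/\mathrm{int}_k^m)$. Fix user $n$; all functions below are functions of the single variable $s_k^n\in\mathcal S_k^n$, with $s_k^m=\tilde s_k^m$ for all $m\ne n$. Given a decomposition $f_k=f_k^1+f_k^2$, the associated approximation is $f_k^1+\mathrm{LIN}(f_k^2)$, where $\mathrm{LIN}(f_k^2)$ is the first-order (affine) Taylor approximation of $f_k^2$ at $s_k^n=\tilde s_k^n$. - $f_k^{\mathrm{CADSB}}$: $f_k^1=-\sum_{m\in\mathcal N}w_m\log(\mathrm{rec}_k^m)$, $f_k^2=\sum_{m\in\mathcal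 N}w_m\log(\mathrm{int}_k^m)$. - $f_k^{\mathrm{IASB1}}$: $f_k^1=-w_n\log(1+s_k^n/\mathrm{int}_k^n)$, $f_k^2=-\sum_{m\ne n}w_m\log(1+s_k^m/\mathrm{int}_k^m)$. - $f_k^{\mathrm{IASB2}}$: $f_k^1=-w_n\log(1+s_k^n/\mathrm{int}_k^n)-L_k^n(s_k^n-\tilde s_k^n)^2$, $f_k^2=-\sum_{m\ne n}w_m\log(1+s_k^m/\mathrm{int}_k^m)+L_k^n(s_k^n-\tilde s_k^n)^2$. The constants $x,y$ are, with $\hat s_k^n=s_k^{n,\mathrm{mask}}$ and $\hat s_k^m=\tilde s_k^m$ for $m\ne n$, $$x=\frac{w_n}{2\left(\hat s_k^n+\sum_{m\ne n}a_k^{n,m}\hat s_k^m+z_k^n\right)^2},$$ $$y=\sum_{m\ne n}\frac{w_m\hat s_k^m(a_k^{m,n})^2\left(\hat s_k^m+2\sum_{p\ne m}a_k^{m,p}\hat s_k^p+2z_k^m\right)/2}{\left(\left(\hat s_k^m+\sum_{p\ne m}a_k^{m,p}\hat s_k^p+z_k^m\right)\left(\sum_{p\ne m}a_k^{m,p}\hat s_k^p+z_k^m\right)\right)^2}.$$ An approximation $A$ is "tighter" than $B$ if its approximation error is no larger along the dimension $s_k^n$: $f_k(s_k^n)\le A(s_k^n)\le B(s_k^n)$ for all $s_k^n\in\mathcal S_k^n$. *)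

theory Defs
  imports "HOL-Analysis.Analysis"
begin

text \<open>
  Users are the naturals in \<open>{1..N}\<close>, tones the elements of an arbitrary type \<open>'k\<close>, and a power
  vector on one tone is a function \<open>s :: nat \<Rightarrow> real\<close> of which only the values on \<open>{1..N}\<close> matter.
  \<open>a k n m\<close> is the gain from user \<open>m\<close> to user \<open>n\<close> on tone \<open>k\<close>.
\<close>

definition interf ::
  "nat \<Rightarrow> ('k \<Rightarrow> nat \<Rightarrow> nat \<Rightarrow> real) \<Rightarrow> ('k \<Rightarrow> nat \<Rightarrow> real) \<Rightarrow> 'k \<Rightarrow> nat \<Rightarrow> (nat \<Rightarrow> real) \<Rightarrow> real"
where
  "interf N a z k n s = (\<Sum>m\<in>{1..N} - {n}. a k n m * s m) + z k n"

definition recv ::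
  "nat \<Rightarrow> ('k \<Rightarrow> nat \<Rightarrow> nat \<Rightarrow> real) \<Rightarrow> ('k \<Rightarrow> nat \<Rightarrow> real) \<Rightarrow> 'k \<Rightarrow> nat \<Rightarrow> (nat \<Rightarrow> real) \<Rightarrow> real"
where
  "recv N a z k n s = s n + interf N a z k n s"

definition objective ::
  "nat \<Rightarrow> (nat \<Rightarrow> real) \<Rightarrow> ('k \<Rightarrow> nat \<Rightarrow> nat \<Rightarrow> real) \<Rightarrow> ('k \<Rightarrow> nat \<Rightarrow> real) \<Rightarrow> 'k \<Rightarrow> (nat \<Rightarrow> real) \<Rightarrow> real"
where
  "objective N w a z k s = - (\<Sum>m\<in>{1..N}. w m * ln (1 + s m / interf N a z k m s))"

definition power_region :: "nat \<Rightarrow> ('k \<Rightarrow> nat \<Rightarrow> real) \<Rightarrow> 'k \<Rightarrow> (nat \<Rightarrow> real) set"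
where
  "power_region N smask k = (\<Pi> m\<in>{1..N}. {0..smask k m})"

definition along :: "nat \<Rightarrow> (nat \<Rightarrow> real) \<Rightarrow> ((nat \<Rightarrow> real) \<Rightarrow> real) \<Rightarrow> real \<Rightarrow> real"
where
  "along n st F = (\<lambda>v. F (st(n := v)))"

text \<open>
  The derivative is two-sided also when \<open>t\<close> is an endpoint of \<open>{0..smask k n}\<close>: since the noise
  powers are positive, all functions linearized below are given by expressions that are
  differentiable in a neighbourhood of \<open>t\<close>.
\<close>

definition LIN :: "(real \<Rightarrow> real) \<Rightarrow> real \<Rightarrow> real \<Rightarrow> real"
where
  "LIN g t = (\<lambda>v. g t + deriv g t * (v - t))"

definition split_approx :: "(real \<Rightarrow> real) \<Rightarrow> (real \<Rightarrow> real) \<Rightarrow> real \<Rightarrow> real \<Rightarrow> real"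
where
  "split_approx f1 f2 t = (\<lambda>v. f1 v + LIN f2 t v)"

definition CADSB ::
  "nat \<Rightarrow> (nat \<Rightarrow> real) \<Rightarrow> ('k \<Rightarrow> nat \<Rightarrow> nat \<Rightarrow> real) \<Rightarrow> ('k \<Rightarrow> nat \<Rightarrow> real) \<Rightarrow> 'k \<Rightarrow> nat \<Rightarrow>
   (nat \<Rightarrow> real) \<Rightarrow> real \<Rightarrow> real"
where
  "CADSB N w a z k n st = split_approx
     (along n st (\<lambda>s. - (\<Sum>m\<in>{1..N}. w m * ln (recv N a z k m s))))
     (along n st (\<lambda>s. \<Sum>m\<in>{1..N}. w m * ln (interf N a z k m s)))
     (st n)"

definition IASB1 ::
  "nat \<Rightarrow> (nat \<Rightarrow> real) \<Rightarrow> ('k \<Rightarrow> nat \<Rightarrow> nat \<Rightarrow> real) \<Rightarrow> ('k \<Rightarrow> nat \<Rightarrow> real) \<Rightarrow> 'k \<Rightarrow> nat \<Rightarrow>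
   (nat \<Rightarrow> real) \<Rightarrow> real \<Rightarrow> real"
where
  "IASB1 N w a z k n st = split_approx
     (along n st (\<lambda>s. - w n * ln (1 + s n / interf N a z k n s)))
     (along n st (\<lambda>s. - (\<Sum>m\<in>{1..N} - {n}. w m * ln (1 + s m / interf N a z k m s))))
     (st n)"

definition IASB2 ::
  "real \<Rightarrow> nat \<Rightarrow> (nat \<Rightarrow> real) \<Rightarrow> ('k \<Rightarrow> nat \<Rightarrow> nat \<Rightarrow> real) \<Rightarrow> ('k \<Rightarrow> nat \<Rightarrow> real) \<Rightarrow> 'k \<Rightarrow> nat \<Rightarrow>
   (nat \<Rightarrow> real) \<Rightarrow> real \<Rightarrow> real"
where
  "IASB2 L N w a z k n st = split_approx
     (along n st (\<lambda>s. - w n * ln (1 + s n / interf N a z k n s) - L * (s n - st n)\<^sup>2))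
     (along n st (\<lambda>s. - (\<Sum>m\<in>{1..N} - {n}. w m * ln (1 + s m / interf N a z k m s))
                      + L * (s n - st n)\<^sup>2))
     (st n)"

definition coef_x ::
  "nat \<Rightarrow> (nat \<Rightarrow> real) \<Rightarrow> ('k \<Rightarrow> nat \<Rightarrow> nat \<Rightarrow> real) \<Rightarrow> ('k \<Rightarrow> nat \<Rightarrow> real) \<Rightarrow> ('k \<Rightarrow> nat \<Rightarrow> real) \<Rightarrow>
   'k \<Rightarrow> nat \<Rightarrow> (nat \<Rightarrow> real) \<Rightarrow> real"
where
  "coef_x N w a z smask k n st =
     (let sh = st(n := smask k n)
      in w n / (2 * (sh n + (\<Sum>m\<in>{1..N} - {n}. a k n m * sh m) + z k n)\<^sup>2))"

definition coef_y ::
  "nat \<Rightarrow> (nat \<Rightarrow> real) \<Rightarrow> ('k \<Rightarrow> nat \<Rightarrow> nat \<Rightarrow> real) \<Rightarrow> ('k \<Rightarrow> nat \<Rightarrow> real) \<Rightarrow> ('k \<Rightarrow> nat \<Rightarrow> real) \<Rightarrow>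
   'k \<Rightarrow> nat \<Rightarrow> (nat \<Rightarrow> real) \<Rightarrow> real"
where
  "coef_y N w a z smask k n st =
     (let sh = st(n := smask k n)
      in \<Sum>m\<in>{1..N} - {n}.
           (w m * sh m * (a k m n)\<^sup>2
              * (sh m + 2 * (\<Sum>p\<in>{1..N} - {m}. a k m p * sh p) + 2 * z k m) / 2)
           / ((sh m + (\<Sum>p\<in>{1..N} - {m}. a k m p * sh p) + z k m)
              * ((\<Sum>p\<in>{1..N} - {m}. a k m p * sh p) + z k m))\<^sup>2)"

definition tighter_on ::
  "real set \<Rightarrow> (real \<Rightarrow> real) \<Rightarrow> (real \<Rightarrow> real) \<Rightarrow> (real \<Rightarrow> real) \<Rightarrow> bool"
where
  "tighter_on S f A B \<longleftrightarrow> (\<forall>v\<in>S. f v \<le> A v \<and> A v \<le> B v)"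

end

theory Submission imports Defs begin

text \<open>
  As a function of the power \<open>v\<close> of user \<open>n\<close>, the rate term of every other user \<open>m\<close> is
  \<open>- w m * ln (1 + s / (g * v + c))\<close>, whose second derivative is nonpositive and largest at the mask,
  where it equals \<open>-2\<close> times the \<open>m\<close>-th summand of \<open>coef_y\<close>. Hence adding \<open>L * (v - t)\<^sup>2\<close> with
  \<open>L \<le> coef_y\<close> keeps these terms concave, and IASB2 lies above the objective. The quadratic
  does not affect the derivative at \<open>t\<close>, so IASB2 is IASB1 minus \<open>L * (v - t)\<^sup>2\<close>, and CADSB differs
  from IASB2 by \<open>L * (v - t)\<^sup>2\<close> plus the nonnegative linearization errors of the concave functions
  \<open>w m * ln (recv m)\<close>.
\<close>

text \<open>Concavity of \<open>ln\<close>, from \<open>ln u \<le> u - 1\<close> at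
  \<open>u = y / x\<close>. It bounds the received-power logarithms in the comparison with
  CADSB.\<close>

lemma ln_le_tangent:
  fixes x y :: real
  assumes "x > 0" "y > 0"
  shows "ln y \<le> ln x + (y - x) / x"
proof -
  have "ln (y / x) \<le> y / x - 1"
    using assms by (intro ln_le_minus_one) simp
  then show ?thesis
    using assms by (simp add: ln_div diff_divide_distrib)
qed

lemma ln_one_plus_ratio:
  fixes s i :: real
  assumes "s \<ge> 0" "i > 0"
  shows "ln (1 + s / i) = ln (s + i) - ln i"
proof -
  have "1 + s / i = (s + i) / i"
    using assms by (simp add: field_simps)
  then show ?thesis
    using assms by (simp add: ln_div)
qed

text \<open>Multiplied by \<open>g\<^sup>2\<close>, the left side at \<open>i = g * v + c\<close> is
  the second derivative in \<open>v\<close> of \<open>ln (1 + s / (g * v + c))\<close>; the right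
  side is the form in which \<open>coef_y\<close> writes it.\<close>

lemma inverse_square_diff:
  fixes s i :: real
  assumes "s \<ge> 0" "i > 0"
  shows "1 / i\<^sup>2 - 1 / (s + i)\<^sup>2 = s * (s + 2 * i) / ((s + i) * i)\<^sup>2"
  using assms by (simp add: divide_simps add_nonneg_eq_0_iff) (simp add: algebra_simps power2_eq_square)

text \<open>The difference factors into nonnegative terms, none of which increases with the
  interference. The curvature of a rate term is therefore smallest at full power.\<close>

lemma inverse_square_diff_antimono:
  fixes s i j :: real
  assumes "s \<ge> 0" "i > 0" "i \<le> j"
  shows "1 / j\<^sup>2 - 1 / (s + j)\<^sup>2 \<le> 1 / i\<^sup>2 - 1 / (s + i)\<^sup>2"
proof -
  have *: "s * (s + 2 * x) / ((s + x) * x)\<^sup>2 = s * (1 / (s + x) + 1 / x) * (1 / ((s + x) * x))"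
    if "x > 0" for x
    using that assms by (simp add: divide_simps power2_eq_square)
  have "s * (1 / (s + j) + 1 / j) * (1 / ((s + j) * j)) \<le> s * (1 / (s + i) + 1 / i) * (1 / ((s + i) * i))"
    using assms by (intro mult_mono add_mono divide_left_mono mult_nonneg_nonneg) auto
  then show ?thesis
    using assms by (simp add: inverse_square_diff * del: times_divide_eq_right)
qed

text \<open>Subtracting a quadratic with the smallest curvature on \<open>{0..M}\<close> leaves
  \<open>ln (1 + s / (g * u + c))\<close> convex there. The bound is the tangent inequality at
  \<open>t\<close>, where the quadratic and its slope vanish.\<close>

lemma neg_log_ratio_quadratic_bound:
  fixes g c s t v M :: real
  assumes "g \<ge> 0" "c > 0" "s \<ge> 0" "t \<in> {0..M}" "v \<in> {0..M}"
  defines "j \<equiv> g * M + c"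
  shows "- ln (1 + s / (g * v + c))
    \<le> - ln (1 + s / (g * t + c)) + (g / (g * t + c) - g / (s + (g * t + c))) * (v - t)
      - s * g\<^sup>2 * (s + 2 * j) / 2 / ((s + j) * j)\<^sup>2 * (v - t)\<^sup>2"
proof -
  define q where "q = s * g\<^sup>2 * (s + 2 * j) / 2 / ((s + j) * j)\<^sup>2"
  define h where "h = (\<lambda>u. ln (s + (g * u + c)) - ln (g * u + c) - q * (u - t)\<^sup>2)"
  define h' where "h' = (\<lambda>u. g / (s + (g * u + c)) - g / (g * u + c) - 2 * q * (u - t))"
  define h'' where "h'' = (\<lambda>u. g\<^sup>2 * (1 / (g * u + c)\<^sup>2 - 1 / (s + (g * u + c))\<^sup>2) - 2 * q)"
  have pos: "g * u + c > 0" if "u \<in> {0..M}" for u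
    using that assms by (simp add: add_nonneg_pos)
  have j: "j > 0"
    using pos[of M] assms by auto
  \<comment> \<open>\<open>2 * q\<close> is the curvature at \<open>u = M\<close>, so
    \<open>h''\<close> vanishes at \<open>M\<close> and is nonnegative to its left.\<close>
  have q: "2 * q = g\<^sup>2 * (1 / j\<^sup>2 - 1 / (s + j)\<^sup>2)"
    using inverse_square_diff[OF \<open>s \<ge> 0\<close> j] by (simp add: q_def mult_ac)
  have tangent: "h' t * (v - t) \<le> h v - h t"
  proof (rule f''_imp_f'[of "{0..M}"])
    fix u assume u: "u \<in> {0..M}"
    have "g * u + c > 0" "s + (g * u + c) > 0"
      using pos[OF u] assms by auto
    then show "DERIV h u :> h' u"
      unfolding h_def h'_def by (auto intro!: derivative_eq_intros)
    show "DERIV h' u :> h'' u"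
      unfolding h'_def h''_def using \<open>g * u + c > 0\<close> \<open>s + (g * u + c) > 0\<close>
      by (auto intro!: derivative_eq_intros simp: power2_eq_square algebra_simps diff_divide_distrib)
    have "g * u + c \<le> j"
      using u assms by (simp add: j_def mult_left_mono)
    then show "h'' u \<ge> 0"
      unfolding h''_def q
      using inverse_square_diff_antimono[OF \<open>s \<ge> 0\<close> pos[OF u]] by (simp add: mult_left_mono)
  qed (use assms in auto)
  have ln_ratio: "ln (1 + s / (g * u + c)) = ln (s + (g * u + c)) - ln (g * u + c)"
    if "u \<in> {0..M}" for u
    using ln_one_plus_ratio[OF \<open>s \<ge> 0\<close> pos[OF that]] .
  show ?thesis
    unfolding ln_ratio[OF assms(4)] ln_ratio[OF assms(5)] q_def[symmetric]
    using tangent by (simp add: h_def h'_def algebra_simps)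
qed

text \<open>Isolates the power of user \<open>n\<close>: the remaining sum is free of
  \<open>v\<close>, which gives the shape \<open>g * v + c\<close> of the quadratic bound.\<close>

lemma interf_upd:
  assumes "n \<in> {1..N}" "m \<noteq> n"
  shows "interf N a z k m (s(n := v))
    = a k m n * v + ((\<Sum>p\<in>{1..N} - {m} - {n}. a k m p * s p) + z k m)"
proof -
  have "n \<in> {1..N} - {m}" using assms by auto
  then have "(\<Sum>p\<in>{1..N} - {m}. a k m p * (s(n := v)) p)
    = a k m n * v + (\<Sum>p\<in>{1..N} - {m} - {n}. a k m p * (s(n := v)) p)"
    by (subst sum.remove[of _ n]) auto
  also have "(\<Sum>p\<in>{1..N} - {m} - {n}. a k m p * (s(n := v)) p)
    = (\<Sum>p\<in>{1..N} - {m} - {n}. a k m p * s p)"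
    by (intro sum.cong) auto
  finally show ?thesis by (simp add: interf_def)
qed

lemma interf_upd_same: "interf N a z k n (s(n := v)) = interf N a z k n s"
  unfolding interf_def by (intro arg_cong2[where f = "(+)"] sum.cong) auto

theorem mainTheorem3:
  fixes N :: nat
    and w :: "nat \<Rightarrow> real"
    and a :: "'k \<Rightarrow> nat \<Rightarrow> nat \<Rightarrow> real"
    and z :: "'k \<Rightarrow> nat \<Rightarrow> real"
    and smask :: "'k \<Rightarrow> nat \<Rightarrow> real"
    and k :: 'k and n :: nat and st :: "nat \<Rightarrow> real" and L :: real
  assumes "\<And>m. m \<in> {1..N} \<Longrightarrow> w m \<ge> 0"
    and "\<And>k m p. m \<in> {1..N} \<Longrightarrow> p \<in> {1..N} \<Longrightarrow> a k m p \<ge> 0"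
    and "\<And>k m. m \<in> {1..N} \<Longrightarrow> z k m > 0"
    and "\<And>k m. m \<in> {1..N} \<Longrightarrow> smask k m > 0"
    and "n \<in> {1..N}"
    and "st \<in> power_region N smask k"
    and "L = coef_y N w a z smask k n st
         \<or> L = min (coef_x N w a z smask k n st) (coef_y N w a z smask k n st)"
  shows "tighter_on {0..smask k n} (along n st (objective N w a z k))
           (IASB2 L N w a z k n st) (IASB1 N w a z k n st)
       \<and> tighter_on {0..smask k n} (along n st (objective N w a z k))
           (IASB2 L N w a z k n st) (CADSB N w a z k n st)"
proof -
  define A where "A = {1..N} - {n}"
  define M where "M = smask k n"
  define t where "t = st n"
  \<comment> \<open>\<open>i m v\<close> is the interference at user \<open>m\<close> when user
    \<open>n\<close> transmits at power \<open>v\<close>; \<open>c m\<close> is the part not caused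
    by \<open>n\<close>. The interference \<open>I\<close> at \<open>n\<close> itself is constant in
    \<open>v\<close>.\<close>
  define c where "c = (\<lambda>m. (\<Sum>p\<in>{1..N} - {m} - {n}. a k m p * st p) + z k m)"
  define i where "i = (\<lambda>m v. a k m n * v + c m)"
  define I where "I = interf N a z k n st"
  \<comment> \<open>The \<open>m\<close>-th summand of \<open>coef_y\<close> without its weight,
    matching the quadratic coefficient of \<open>neg_log_ratio_quadratic_bound\<close>.\<close>
  define y where "y = (\<lambda>m. st m * (a k m n)\<^sup>2 * (st m + 2 * i m M) / 2 / ((st m + i m M) * i m M)\<^sup>2)"
  define R where "R = (\<lambda>v. \<Sum>m\<in>A. w m * ln (st m + i m v))"
  define J where "J = (\<lambda>v. \<Sum>m\<in>A. w m * ln (i m v))"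
  define E where "E = (\<lambda>v. - (\<Sum>m\<in>A. w m * ln (1 + st m / i m v)))"
  define dR where "dR = (\<Sum>m\<in>A. w m * (a k m n / (st m + i m t)))"
  define dJ where "dJ = (\<Sum>m\<in>A. w m * (a k m n / i m t))"

  have st: "st m \<ge> 0" "st m \<le> smask k m" if "m \<in> {1..N}" for m
    using assms(6) that by (auto simp: power_region_def Pi_def)
  have t: "t \<in> {0..M}"
    using st[OF assms(5)] by (simp add: t_def M_def)
  have M: "M \<in> {0..M}"
    using t by auto
  have A: "m \<in> {1..N}" "m \<noteq> n" "w m \<ge> 0" "a k m n \<ge> 0" "st m \<ge> 0" if "m \<in> A" for m
    using that assms st by (auto simp: A_def)
  have c: "c m > 0" if "m \<in> A" for m
    unfolding c_def using A[OF that] assms st by (intro add_nonneg_pos sum_nonneg mult_nonneg_nonneg) auto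
  have i: "i m v > 0" if "m \<in> A" "v \<in> {0..M}" for m v
    unfolding i_def using A[OF that(1)] c[OF that(1)] that(2) by (simp add: add_nonneg_pos)
  have I: "I > 0"
    unfolding I_def interf_def using assms st by (intro add_nonneg_pos sum_nonneg mult_nonneg_nonneg) auto
  have upd: "interf N a z k m (st(n := v)) = i m v" "(st(n := v)) m = st m" if "m \<in> A" for m v
    using interf_upd[OF assms(5) A(2)[OF that]] A(2)[OF that] by (auto simp: i_def c_def)
  have user_n: "interf N a z k n (st(n := v)) = I" for v
    by (simp add: interf_upd_same I_def)
  have split_n: "(\<Sum>m\<in>{1..N}. F m) = F n + (\<Sum>m\<in>A. F m)" for F :: "nat \<Rightarrow> real"
    unfolding A_def using assms(5) by (subst sum.remove[of _ n]) auto

  have E: "E v = J v - R v" if "v \<in> {0..M}" for v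
    using A(5) i that
    by (simp add: E_def J_def R_def ln_one_plus_ratio right_diff_distrib sum_subtractf)

  have rates: "along n st (\<lambda>s. - (\<Sum>m\<in>{1..N} - {n}. w m * ln (1 + s m / interf N a z k m s))) = E"
    unfolding A_def[symmetric] by (simp add: along_def E_def upd A(2))
  have obj: "along n st (objective N w a z k) v = - w n * ln (1 + v / I) + E v" for v
    by (simp add: along_def objective_def split_n E_def upd A(2) user_n del: One_nat_def)

  have dR: "(R has_real_derivative dR) (at t)"
    unfolding R_def dR_def using i[OF _ t] A(5)
    by (auto intro!: derivative_eq_intros sum.cong simp: i_def add_nonneg_pos)
  have dJ: "(J has_real_derivative dJ) (at t)"
    unfolding J_def dJ_def using i[OF _ t]
    by (auto intro!: derivative_eq_intros sum.cong simp: i_def)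
  have dE: "(E has_real_derivative dJ - dR) (at t)"
  proof -
    \<comment> \<open>\<open>t\<close> may be an endpoint of \<open>{0..M}\<close> while
      \<open>deriv\<close> is two-sided, so \<open>E = J - R\<close> is needed on a full
      neighbourhood. Continuity keeps the finitely many interferences positive there.\<close>
    have "\<forall>\<^sub>F v in nhds t. \<forall>m\<in>A. i m v > 0"
    proof (rule eventually_ball_finite)
      show "\<forall>m\<in>A. \<forall>\<^sub>F v in nhds t. i m v > 0"
      proof
        fix m assume "m \<in> A"
        have "(i m \<longlongrightarrow> i m t) (nhds t)"
          unfolding i_def by (intro tendsto_intros filterlim_ident)
        then show "\<forall>\<^sub>F v in nhds t. i m v > 0"
          using i[OF \<open>m \<in> A\<close> t] by (rule order_tendstoD)
      qed
    qed (simp add: A_def)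
    then have "\<forall>\<^sub>F v in nhds t. E v = J v - R v"
      by eventually_elim
        (simp add: E_def J_def R_def A(5) ln_one_plus_ratio right_diff_distrib sum_subtractf)
    moreover have "((\<lambda>v. J v - R v) has_real_derivative dJ - dR) (at t)"
      by (intro derivative_intros dJ dR)
    ultimately show ?thesis
      by (subst DERIV_cong_ev[OF refl _ refl])
  qed

  have IASB1: "IASB1 N w a z k n st v = - w n * ln (1 + v / I) + (E t + (dJ - dR) * (v - t))" for v
    unfolding IASB1_def split_approx_def LIN_def rates
    by (simp add: DERIV_imp_deriv[OF dE] along_def user_n flip: t_def)
  have IASB2: "IASB2 L N w a z k n st v = IASB1 N w a z k n st v - L * (v - t)\<^sup>2" for v
  proof -
    have eq: "along n st (\<lambda>s. - (\<Sum>m\<in>{1..N} - {n}. w m * ln (1 + s m / interf N a z k m s))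
      + L * (s n - st n)\<^sup>2) = (\<lambda>v. E v + L * (v - t)\<^sup>2)"
      using rates by (simp add: along_def t_def fun_eq_iff)
    have "((\<lambda>v. E v + L * (v - t)\<^sup>2) has_real_derivative dJ - dR) (at t)"
      by (auto intro!: derivative_eq_intros dE)
    then show ?thesis
      unfolding IASB2_def split_approx_def LIN_def eq IASB1
      by (simp add: DERIV_imp_deriv along_def user_n flip: t_def)
  qed
  have CADSB: "CADSB N w a z k n st v
    = - w n * ln (v + I) - R v + (w n * ln I + J t + dJ * (v - t))" for v
  proof -
    have eq: "along n st (\<lambda>s. \<Sum>m\<in>{1..N}. w m * ln (interf N a z k m s)) = (\<lambda>v. w n * ln I + J v)"
      by (simp add: along_def split_n J_def upd user_n fun_eq_iff del: One_nat_def)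
    have "((\<lambda>v. w n * ln I + J v) has_real_derivative dJ) (at t)"
      by (auto intro!: derivative_eq_intros dJ)
    then show ?thesis
      unfolding CADSB_def split_approx_def LIN_def eq
      by (simp add: DERIV_imp_deriv along_def split_n R_def recv_def upd A(2) user_n
          del: One_nat_def flip: t_def)
  qed

  have y_nonneg: "y m \<ge> 0" if "m \<in> A" for m
    unfolding y_def using A(5)[OF that] i[OF that M] by simp
  have coef_y: "coef_y N w a z smask k n st = (\<Sum>m\<in>A. w m * y m)"
  proof -
    \<comment> \<open>\<open>coef_y\<close> lists the noise separately from the interference sum,
      whereas \<open>i m M\<close> includes it.\<close>
    have "(\<Sum>p\<in>{1..N} - {m}. a k m p * (st(n := M)) p) = i m M - z k m" if "m \<in> A" for m
      using upd(1)[OF that, of M] by (simp add: interf_def)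
    then show ?thesis
      unfolding coef_y_def Let_def y_def M_def[symmetric] A_def[symmetric]
      by (intro sum.cong refl) (simp add: upd(2) mult.assoc del: One_nat_def fun_upd_apply)
  qed
  \<comment> \<open>Both choices of \<open>L\<close> obey these bounds, the minimum because
    \<open>coef_x\<close> and \<open>coef_y\<close> are nonnegative. The upper bound keeps IASB2
    above the objective; the lower one keeps it below IASB1 and CADSB.\<close>
  have L: "0 \<le> L" "L \<le> (\<Sum>m\<in>A. w m * y m)"
  proof -
    have "coef_x N w a z smask k n st \<ge> 0"
      using assms(1,5) by (simp add: coef_x_def Let_def)
    moreover have "(\<Sum>m\<in>A. w m * y m) \<ge> 0"
      using A(3) y_nonneg by (intro sum_nonneg mult_nonneg_nonneg)
    ultimately show "0 \<le> L" "L \<le> (\<Sum>m\<in>A. w m * y m)"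
      using assms(7) coef_y by auto
  qed

  have below: "along n st (objective N w a z k) v \<le> IASB2 L N w a z k n st v" if v: "v \<in> {0..M}" for v
  proof -
    have "E v = (\<Sum>m\<in>A. w m * - ln (1 + st m / i m v))"
      by (simp add: E_def sum_negf)
    also have "\<dots> \<le> (\<Sum>m\<in>A. w m * (- ln (1 + st m / i m t)
      + (a k m n / i m t - a k m n / (st m + i m t)) * (v - t) - y m * (v - t)\<^sup>2))"
      unfolding y_def i_def
      by (intro sum_mono mult_left_mono neg_log_ratio_quadratic_bound A c t v)
    also have "\<dots> = E t + (dJ - dR) * (v - t) - (\<Sum>m\<in>A. w m * y m) * (v - t)\<^sup>2"
      unfolding E_def dJ_def dR_def sum_distrib_right
        sum_negf[symmetric] sum.distrib[symmetric] sum_subtractf[symmetric]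
      by (intro sum.cong refl) (simp add: algebra_simps)
    also have "\<dots> \<le> E t + (dJ - dR) * (v - t) - L * (v - t)\<^sup>2"
      using L(2) by (simp add: mult_right_mono)
    finally show ?thesis
      by (simp add: obj IASB2 IASB1)
  qed
  have above_CADSB: "IASB2 L N w a z k n st v \<le> CADSB N w a z k n st v" if v: "v \<in> {0..M}" for v
  proof -
    have "R v \<le> (\<Sum>m\<in>A. w m * (ln (st m + i m t) + ((st m + i m v) - (st m + i m t)) / (st m + i m t)))"
      unfolding R_def using i[OF _ v] i[OF _ t] A
      by (intro sum_mono mult_left_mono ln_le_tangent) (auto intro: add_nonneg_pos)
    also have "\<dots> = (\<Sum>m\<in>A. w m * (ln (st m + i m t) + a k m n / (st m + i m t) * (v - t)))"
      by (simp add: i_def algebra_simps)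
    also have "\<dots> = R t + dR * (v - t)"
      by (simp add: R_def dR_def sum_distrib_right distrib_left sum.distrib mult.assoc)
    finally have "R v \<le> R t + dR * (v - t)" .
    \<comment> \<open>The own-rate term of user \<open>n\<close> is thus identical in IASB2 and
      CADSB, and only the linearization error of \<open>R\<close> and the quadratic remain.\<close>
    moreover have "w n * ln (1 + v / I) = w n * ln (v + I) - w n * ln I"
      using v I by (simp add: ln_one_plus_ratio right_diff_distrib)
    moreover have "L * (v - t)\<^sup>2 \<ge> 0"
      using L(1) by simp
    ultimately show ?thesis
      by (simp add: IASB2 IASB1 CADSB E[OF t] algebra_simps)
  qed
  have "IASB2 L N w a z k n st v \<le> IASB1 N w a z k n st v" for v
    using L(1) by (simp add: IASB2)
  with below above_CADSB show ?thesis
    by (simp add: tighter_on_def M_def)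
qed

end
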